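(* Given five integers $k,l,m,n,r$ such that $0<r\le k\le m$ and $r\le l\le n$, suppose that two successive C–A steps (say, based on the Gu–Eisenstat strong rank-revealing QR algorithms) combined with the reduction algorithm from maximal volume to maximal $r$-projective volume (both described in the context) have been applied to an $m\times n$ matrix $W$ of rank $r$ and have output a pair of $k\times l$ submatrices $W_1'$ and $W_2'=W_{\mathcal I_2,\mathcal J_2}$ such that $W_1'$ has nonzero column-wise locally $h$-maximal $r$-projective volume and $W_2'$ has nonzero row-wise locally $h'$-maximal $r$-projective volume. Then the submatrix $W_2'$ has $h'h$-maximal $r$-projective volume in the matrix $W$, that is, $v_{2,r}(B)\le h'h\,v_{2,r}(W_2')$ for every $k\times l$ submatrix $B$ of $W$.
   Context: Matrices are real. For a $k\times l$ matrix $M$ with singular values $\sigma_1(M)\ge\sigma_2(M)\ge\cdots$ and $1\le r\le\min\{k,l\}$, the volume is $v_2(M)=\prod_{j=1}^{\min\{k,l\}}\sigma_j(M)$ and the $r$-projective volume is $v_{2,r}(M)=\prod_{j=1}^{r}\sigma_j(M)$. For index sets $\mathcal I\subseteq\{1,\dots,m\}$, $\mathcal J\subseteq\{1,\dots,n\}$, $W_{\mathcal I,\mathcal J}$ is the submatrix of $W$ with rows in $\mathcal I$ and columns in $\mathcal J$, while $W_{\mathcal I,:}$ and $W_{:,\mathcal J}$ consist of full rows, respectively full columns. For $h\ge1$, the ($r$-projective) volume of a $k\times l$ submatrix is $h$-maximal over a family of $k\times l$ submatrices if it is maximal over this family up to a factor of $h$ ("maximal" means $1$-maximal). The ($r$-projective)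 volume of $W_{\mathcal I,\mathcal J}$ is column-wise (respectively row-wise) locally $h$-maximal if it is $h$-maximal over all submatrices of $W$ that differ from $W_{\mathcal I,\mathcal J}$ by a single column (respectively a single row). Cross-Approximation (C–A) steps alternate between two kinds. A horizontal step starts with a set $\mathcal I$ of row indices and selects a $k\times l$ submatrix $W_{\mathcal I,\mathcal J}$ of $W_{\mathcal I,:}$; a vertical step starts with a set $\mathcal J$ of column indices and selects a $k\times l$ submatrix $W_{\mathcal I,\mathcal J}$ of $W_{:,\mathcal J}$. In each step the selection is made by a subroutine that seeks a $k\times l$ submatrix whose volume or projective volume is maximal up to a fixed factor, and each step starts from the index set selected by the previous step. Reduction algorithm: given a $k\times n$ matrix $V$ of rank $r$, with $0<r\le k\le n$ and $r\le l\le n$, and a black-box algorithm that finds an $r\times l$ submatrix having locally maximal volume in an $r\times n$ matrix of full rank $r$: compute a rank-revealing factorization $V=QRP$, where $Q$ is orthogonal, $P$ is a permutation matrix, $R=\begin{pmatrix}R'\\O\end{pmatrix}$, and $R'$ is an $r\times n$ matrix; compute an $r\times l$ submatrix $R'_{:,\mathcal J}$ of $R'$ having maximal volume; output the column set $\mathcal J'$ that $P$ maps to $\mathcal J$. By transposition the algorithm is extended to selecting a $k\times l$ submatrix of an $m\times l$ matrix of rank $r$.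
   Formalization: The reduction algorithm is assumed to choose columns of R' whose volume is maximal up to factor h (then h') among all submatrices of that size, not just locally; with local maximality alone the claim fails, e.g. for W=[[1,0,1,-1],[0,1,1,1]], k=l=r=2, h=h'=1. *)

theory Defs
  imports
    Jordan_Normal_Form.Char_Poly
    Jordan_Normal_Form.DL_Rank
    Jordan_Normal_Form.DL_Submatrix
    "HOL-Combinatorics.Permutations"
    "HOL-Library.Multiset"
begin

(* The square roots of the eigenvalues of M\<^sup>T M (all of which are real and nonnegative),
   repeated according to algebraic multiplicity, in decreasing order. The list has dim_col M
   entries; those beyond position min (dim_row M) (dim_col M) are zero. *)
definition singular_values :: "real mat \<Rightarrow> real list" where
  "singular_values M =
     rev (sorted_list_of_multiset (image_mset sqrt (proots (char_poly (transpose_mat M * M)))))"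

definition proj_volume :: "nat \<Rightarrow> real mat \<Rightarrow> real" where
  "proj_volume r M = prod_list (take r (singular_values M))"

definition volume :: "real mat \<Rightarrow> real" where
  "volume M = proj_volume (min (dim_row M) (dim_col M)) M"

(* Indices start at 0. Index sets are listed increasingly by submatrix; taking UNIV as an
   index set keeps all rows or all columns. *)
definition submatrices :: "nat \<Rightarrow> nat \<Rightarrow> real mat \<Rightarrow> real mat set" where
  "submatrices k l W = {submatrix W I J | I J.
     I \<subseteq> {..<dim_row W} \<and> card I = k \<and> J \<subseteq> {..<dim_col W} \<and> card J = l}"

definition h_maximal :: "(real mat \<Rightarrow> real) \<Rightarrow> real \<Rightarrow> real mat set \<Rightarrow> real mat \<Rightarrow> bool" where
  "h_maximal vol h \<F> M \<longleftrightarrow> (\<forall>B\<in>\<F>. vol B \<le> h * vol M)"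

definition column_neighbours :: "real mat \<Rightarrow> nat set \<Rightarrow> nat set \<Rightarrow> real mat set" where
  "column_neighbours W I J = {submatrix W I J' | J'.
     J' \<subseteq> {..<dim_col W} \<and> card J' = card J \<and> card (J - J') = 1}"

definition row_neighbours :: "real mat \<Rightarrow> nat set \<Rightarrow> nat set \<Rightarrow> real mat set" where
  "row_neighbours W I J = {submatrix W I' J | I'.
     I' \<subseteq> {..<dim_row W} \<and> card I' = card I \<and> card (I - I') = 1}"

definition columnwise_locally_h_maximal ::
  "(real mat \<Rightarrow> real) \<Rightarrow> real \<Rightarrow> real mat \<Rightarrow> nat set \<Rightarrow> nat set \<Rightarrow> bool" where
  "columnwise_locally_h_maximal vol h W I J \<longleftrightarrow>
     h_maximal vol h (column_neighbours W I J) (submatrix W I J)"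

definition rowwise_locally_h_maximal ::
  "(real mat \<Rightarrow> real) \<Rightarrow> real \<Rightarrow> real mat \<Rightarrow> nat set \<Rightarrow> nat set \<Rightarrow> bool" where
  "rowwise_locally_h_maximal vol h W I J \<longleftrightarrow>
     h_maximal vol h (row_neighbours W I J) (submatrix W I J)"

(* A * perm_mat n \<pi> has column \<pi> j of A as its column j. *)
definition perm_mat :: "nat \<Rightarrow> (nat \<Rightarrow> nat) \<Rightarrow> real mat" where
  "perm_mat n \<pi> = mat n n (\<lambda>(i, j). if i = \<pi> j then 1 else 0)"

(* J' is a possible output of the reduction algorithm on the input V of rank r, when its
   subroutine returns an r x l submatrix of R' whose volume is maximal up to the factor h among
   all r x l submatrices of R'; h = 1 is the exact algorithm. As columns J' of V are, up to their
   order, Q times columns \<pi> ` J' of R, the algorithm outputs the set J' with \<pi> ` J' = J.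
   (The library's orthogonal_mat does not normalize the columns and is not the notion meant.) *)
definition reduction_output :: "real \<Rightarrow> nat \<Rightarrow> nat \<Rightarrow> real mat \<Rightarrow> nat set \<Rightarrow> bool" where
  "reduction_output h r l V J' \<longleftrightarrow>
     (let k = dim_row V; n = dim_col V in
      vec_space.rank k V = r \<and>
      (\<exists>Q R R' \<pi> J.
         Q \<in> carrier_mat k k \<and> transpose_mat Q * Q = 1\<^sub>m k \<and>
         R' \<in> carrier_mat r n \<and> R = R' @\<^sub>r 0\<^sub>m (k - r) n \<and>
         \<pi> permutes {..<n} \<and>
         V = Q * R * perm_mat n \<pi> \<and>
         J \<subseteq> {..<n} \<and> card J = l \<and>
         h_maximal volume h (submatrices r l R') (submatrix R' UNIV J) \<and>
         J' \<subseteq> {..<n} \<and> \<pi> ` J' = J))"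

definition horizontal_step :: "real \<Rightarrow> nat \<Rightarrow> nat \<Rightarrow> real mat \<Rightarrow> nat set \<Rightarrow> nat set \<Rightarrow> bool" where
  "horizontal_step h r l W I J \<longleftrightarrow> reduction_output h r l (submatrix W I UNIV) J"

definition vertical_step :: "real \<Rightarrow> nat \<Rightarrow> nat \<Rightarrow> real mat \<Rightarrow> nat set \<Rightarrow> nat set \<Rightarrow> bool" where
  "vertical_step h r k W J I \<longleftrightarrow>
     reduction_output h r k (transpose_mat (submatrix W UNIV J)) I"

end

theory Submission
  imports Defs
begin

text \<open>
  Factor \<open>W = F G\<close> through dimension \<open>r\<close>. The nonzero spectrum of \<open>M\<^sup>T M\<close> for
  \<open>M = F\<^sub>I G\<^sub>J\<close> is that of the \<open>r \<times> r\<close> matrix \<open>(F\<^sub>I\<^sup>T F\<^sub>I) (G\<^sub>J G\<^sub>J\<^sup>T)\<close>, so the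
  \<open>r\<close>-projective volume of every submatrix splits as
  \<open>v\<^sub>r(W\<^sub>I\<^sub>J) = sqrt (a(I) b(J))\<close> with \<open>a(I) = det (F\<^sub>I\<^sup>T F\<^sub>I)\<close> and \<open>b(J) = det (G\<^sub>J G\<^sub>J\<^sup>T)\<close>.
  In a row block of nonzero \<open>a\<close> the reduction algorithm therefore bounds every \<open>b(J)\<close> by
  \<open>h\<^sup>2 b(J\<^sub>1)\<close>, whatever the row block is, and the vertical step bounds every \<open>a(I)\<close> by
  \<open>h'\<^sup>2 a(I\<^sub>2)\<close>; multiplying the two bounds gives the claim.
\<close>

section \<open>Characteristic polynomials of block matrices and of swapped products\<close>

lemma char_poly_four_block_upper_right_zero:
  fixes A1 :: "'a :: idom mat"
  assumes A1: "A1 \<in> carrier_mat n n" and A3: "A3 \<in> carrier_mat m n" and A4: "A4 \<in> carrier_mat m m"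
  shows "char_poly (four_block_mat A1 (0\<^sub>m n m) A3 A4) = char_poly A1 * char_poly A4"
proof -
  have "char_poly_matrix (four_block_mat A1 (0\<^sub>m n m) A3 A4)
    = four_block_mat (char_poly_matrix A1) (0\<^sub>m n m) (map_mat (\<lambda>a. [:-a:]) A3) (char_poly_matrix A4)"
    using assms by (intro eq_matI) (auto simp: char_poly_matrix_def)
  then show ?thesis
    unfolding char_poly_def
    using det_four_block_mat_upper_right_zero[OF char_poly_matrix_closed[OF A1] refl _
        char_poly_matrix_closed[OF A4], of "map_mat (\<lambda>a. [:-a:]) A3"] A3 by simp
qed

lemma char_poly_zero_mat: "char_poly (0\<^sub>m n n :: 'a :: comm_ring_1 mat) = [:0, 1:] ^ n"
proof -
  have "diag_mat (0\<^sub>m n n :: 'a mat) = replicate n 0"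
    by (auto simp: diag_mat_def intro: nth_equalityI)
  then show ?thesis
    using char_poly_upper_triangular[of "0\<^sub>m n n :: 'a mat" n]
    by (simp add: prod_list_replicate)
qed

text \<open>\<open>(AB 0; B 0)\<close> and \<open>(0 0; B BA)\<close> are conjugate by \<open>(1 A; 0 1)\<close>.\<close>
lemma char_poly_mult_commute:
  fixes A :: "'a :: idom mat"
  assumes A: "A \<in> carrier_mat l r" and B: "B \<in> carrier_mat r l"
  shows "char_poly (A * B) * [:0, 1:] ^ r = [:0, 1:] ^ l * char_poly (B * A)"
proof -
  let ?X = "four_block_mat (A * B) (0\<^sub>m l r) B (0\<^sub>m r r)"
  let ?Y = "four_block_mat (0\<^sub>m l l) (0\<^sub>m l r) B (B * A)"
  let ?P = "four_block_mat (1\<^sub>m l) A (0\<^sub>m r l) (1\<^sub>m r)"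
  let ?Q = "four_block_mat (1\<^sub>m l) (- A) (0\<^sub>m r l) (1\<^sub>m r)"
  have AB: "A * B \<in> carrier_mat l l" and BA: "B * A \<in> carrier_mat r r"
    and ABA: "A * (B * A) \<in> carrier_mat l r"
    using A B by auto
  have [simp]: "- 0\<^sub>m r r + 1\<^sub>m r = (1\<^sub>m r :: 'a mat)"
    by (intro eq_matI) auto
  have [simp]: "A + - A = 0\<^sub>m l r" "- A + A = 0\<^sub>m l r"
    using A by (auto intro!: eq_matI)
  have "?P * ?Q = 1\<^sub>m (l + r)" "?Q * ?P = 1\<^sub>m (l + r)"
    using A by (subst mult_four_block_mat[of _ l l _ r _ r _ _ l _ r];
        auto simp: uminus_l_inv_mat)+
  moreover have "?P * ?Y * ?Q = ?X"
  proof -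
    have "?P * ?Y = four_block_mat (A * B) (A * (B * A)) B (B * A)"
      using A B AB BA ABA
      by (subst mult_four_block_mat[of _ l l _ r _ r _ _ l _ r]) auto
    also have "\<dots> * ?Q = ?X"
      using A B AB BA ABA
      by (subst mult_four_block_mat[of _ l l _ r _ r _ _ l _ r])
         (auto simp: uminus_l_inv_mat)
    finally show ?thesis .
  qed
  ultimately have "similar_mat ?X ?Y"
    unfolding similar_mat_def similar_mat_wit_def using A B AB BA
    by (intro exI[of _ ?P] exI[of _ ?Q]) (auto simp: Let_def)
  then have "char_poly ?X = char_poly ?Y"
    by (rule char_poly_similar)
  then show ?thesis
    using assms AB BA by (simp add: char_poly_four_block_upper_right_zero char_poly_zero_mat)
qed

section \<open>Singular values and projective volume of a product\<close>

text \<open>Over the complex numbers the polynomial splits, and an eigenvector \<open>v\<close> for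
  a root \<open>c\<close> satisfies \<open>c <v,v> = <Av,Av>\<close>, which makes \<open>c\<close>
  real and nonnegative. The factorization descends to the reals because the embedding of real
  polynomials is injective.\<close>

lemma char_poly_gram_splits:
  fixes A :: "real mat"
  assumes A: "A \<in> carrier_mat k l"
  shows "\<exists>as. char_poly (transpose_mat A * A) = (\<Prod>a\<leftarrow>as. [:-a, 1:]) \<and> length as = l \<and> (\<forall>a\<in>set as. 0 \<le> a)"
proof -
  let ?M = "transpose_mat A * A" and ?c = "complex_of_real"
  let ?A = "map_mat ?c A"
  interpret map_poly: map_poly_inj_idom_hom ?c ..
  let ?MC = "map_mat ?c ?M"
  have M: "?M \<in> carrier_mat l l" and MC: "?MC \<in> carrier_mat l l" and AC: "?A \<in> carrier_mat k l"
    using A by auto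
  have MC_eq: "?MC = transpose_mat ?A * ?A"
    by (subst of_real_hom.mat_hom_mult[of _ l k _ l]) (use A in \<open>auto simp: map_mat_transpose\<close>)
  obtain cs where cs: "char_poly ?MC = (\<Prod>a\<leftarrow>cs. [:-a, 1:])" "length cs = l"
    using char_poly_factorized[OF MC] by blast
  \<comment> \<open>In the order on complex numbers, \<open>0 \<le> c\<close> also says that
    \<open>c\<close> is real.\<close>
  have ge0: "0 \<le> c" if "c \<in> set cs" for c
  proof -
    have "poly (char_poly ?MC) c = 0"
      unfolding cs using that by (auto simp: poly_prod_list prod_list_zero_iff image_iff)
    then obtain v where v: "v \<in> carrier_vec l" "v \<noteq> 0\<^sub>v l" "?MC *\<^sub>v v = c \<cdot>\<^sub>v v"
      using MC unfolding eigenvalue_root_char_poly[OF MC, symmetric] eigenvalue_def eigenvector_def by auto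
    have conj: "conjugate (?A *\<^sub>v v) = ?A *\<^sub>v conjugate v"
      using A v(1) by (intro eq_vecI) (auto simp: scalar_prod_def conjugate_vec_def sum_conjugate)
    have "c * (v \<bullet>c v) = (?MC *\<^sub>v v) \<bullet>c v"
      using v by simp
    also have "\<dots> = (?A *\<^sub>v v) \<bullet>c (?A *\<^sub>v v)"
      unfolding MC_eq conj using AC v(1)
      by (simp add: assoc_mult_mat_vec[of _ l k _ l] transpose_vec_mult_scalar[of _ k l])
    finally have *: "c * (v \<bullet>c v) = (?A *\<^sub>v v) \<bullet>c (?A *\<^sub>v v)" .
    have "0 < v \<bullet>c v" using v by (simp add: conjugate_square_greater_0_vec)
    moreover have "0 \<le> (?A *\<^sub>v v) \<bullet>c (?A *\<^sub>v v)" by (rule conjugate_square_ge_0_vec)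
    ultimately show ?thesis using *
      by (smt (verit, best) less_eq_complex_def less_complex_def mult.commute mult_zero_left
          nonzero_mult_div_cancel_right complex_eq_iff times_complex.sel zero_complex.sel
          zero_le_mult_iff)
  qed
  define as where "as = map Re cs"
  have cs_as: "cs = map ?c as"
    using ge0 by (auto simp: as_def less_eq_complex_def complex_eq_iff intro!: nth_equalityI)
  have "map_poly ?c (char_poly ?M) = map_poly ?c (\<Prod>a\<leftarrow>as. [:-a, 1:])"
    unfolding of_real_hom.char_poly_hom[OF M, symmetric] cs cs_as
    by (simp add: map_poly.hom_prod_list o_def)
  then have "char_poly ?M = (\<Prod>a\<leftarrow>as. [:-a, 1:])" by simp
  moreover have "length as = l" "\<forall>a\<in>set as. 0 \<le> a"
    using cs ge0 by (auto simp: as_def less_eq_complex_def)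
  ultimately show ?thesis by blast
qed

text \<open>Up to a factor \<open>x^(l - r)\<close>, the Gram matrix of \<open>F * G\<close> has the
  characteristic polynomial of the \<open>r\<close> by \<open>r\<close> product of the two small
  Gram matrices. That factor accounts for \<open>l - r\<close> zero singular values; the squares of
  the other \<open>r\<close> multiply to the determinant of the small product.\<close>

lemma proj_volume_mult:
  fixes F G :: "real mat"
  assumes F: "F \<in> carrier_mat k r" and G: "G \<in> carrier_mat r l" and rl: "r \<le> l"
  shows "0 \<le> det (transpose_mat F * F) * det (G * transpose_mat G)"
    and "proj_volume r (F * G) = sqrt (det (transpose_mat F * F) * det (G * transpose_mat G))"
proof -
  \<comment> \<open>The Gram matrix of \<open>F * G\<close> is cut as \<open>?B * ?C\<close> right
    after the transpose of \<open>G\<close>, so that the swapped product \<open>?C * ?B\<close> is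
    \<open>?S * ?T\<close>.\<close>
  let ?C = "transpose_mat F * (F * G)"
  let ?B = "transpose_mat G"
  let ?S = "transpose_mat F * F" and ?T = "G * transpose_mat G"
  let ?p = "char_poly (transpose_mat (F * G) * (F * G))"
  let ?q = "char_poly (?S * ?T)"
  have B: "?B \<in> carrier_mat l r" and C: "?C \<in> carrier_mat r l" and FG: "F * G \<in> carrier_mat k l"
    and ST: "?S * ?T \<in> carrier_mat r r" and S: "?S \<in> carrier_mat r r" and T: "?T \<in> carrier_mat r r"
    using F G by auto
  have "?B * ?C = transpose_mat (F * G) * (F * G)"
    unfolding transpose_mult[OF F G] using F G
    by (subst assoc_mult_mat[of _ l r _ k _ l]) auto
  moreover have "?C * ?B = ?S * ?T"
    using F G
    by (simp add: assoc_mult_mat[of _ r k _ r _ r] assoc_mult_mat[of _ r k _ l _ r]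
        assoc_mult_mat[of _ k r _ l _ r])
  \<comment> \<open>Since \<open>r \<le> l\<close>, the power \<open>x^l\<close> contains
    \<open>x^r\<close>, which is then cancelled.\<close>
  ultimately have "?p * [:0, 1:] ^ r = [:0, 1:] ^ (l - r) * ?q * [:0, 1:] ^ r"
    using char_poly_mult_commute[OF B C] rl by (simp add: power_add[symmetric] mult.assoc mult.commute)
  then have p: "?p = [:0, 1:] ^ (l - r) * ?q" by simp
  obtain as where as: "?p = (\<Prod>a\<leftarrow>as. [:-a, 1:])" "length as = l" "\<forall>a\<in>set as. 0 \<le> a"
    using char_poly_gram_splits[OF FG] by blast
  have q0: "?q \<noteq> 0" using degree_monic_char_poly[OF ST] by auto
  have proots_as: "proots (\<Prod>a\<leftarrow>as. [:-a, 1:]) = mset as" for as :: "real list"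
  proof (induction as)
    case (Cons a as)
    have "(\<Prod>a\<leftarrow>as. [:-a, 1:]) \<noteq> 0" by (auto simp: prod_list_zero_iff)
    then have "proots ([:-a, 1:] * (\<Prod>a\<leftarrow>as. [:-a, 1:])) = {#a#} + mset as"
      using Cons by (subst proots_mult) auto
    then show ?case by simp
  qed simp
  \<comment> \<open>It is not yet known that \<open>?q\<close> splits over the reals. Comparing
    roots with those of \<open>?p\<close> shows that \<open>bs\<close> has \<open>r\<close>
    nonnegative entries, and cancelling \<open>x^(l - r)\<close> then gives the factorization of
    \<open>?q\<close>.\<close>
  obtain bs where bs: "mset bs = proots ?q" using ex_mset by blast
  have as_bs: "mset as = mset (replicate (l - r) 0 @ bs)"
    unfolding proots_as[of as, folded as(1), symmetric] p using q0 bs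
    by (simp add: proots_mult proots_power)
  have bs0: "\<forall>b\<in>set bs. 0 \<le> b" and len: "length bs = r"
    using arg_cong[OF as_bs, of set_mset] arg_cong[OF as_bs, of size] as(2,3) rl by auto
  have "?p = (\<Prod>a\<leftarrow>replicate (l - r) 0 @ bs. [:-a, 1:])"
    unfolding as(1) prod_mset_prod_list[symmetric] mset_map as_bs ..
  then have "?q = (\<Prod>a\<leftarrow>bs. [:-a, 1:])"
    unfolding p by (simp add: prod_list_replicate)
  \<comment> \<open>The constant coefficient identifies the determinant with the product of the
    roots; the sign \<open>(-1)^r\<close> occurs on both sides.\<close>
  moreover have "poly ?q 0 = (-1) ^ r * det (?S * ?T)"
  proof -
    have "- char_matrix M 0 = (-1) \<cdot>\<^sub>m M" if "M \<in> carrier_mat r r" for M :: "real mat"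
      using that unfolding char_matrix_def by (intro eq_matI) auto
    from this[OF ST] show ?thesis
      unfolding char_poly_matrix[OF ST] using carrier_matD(2)[OF ST] by (simp only: det_smult)
  qed
  ultimately have "(-1) ^ r * det (?S * ?T) = (\<Prod>b\<leftarrow>bs. - b)"
    by (simp add: poly_prod_list o_def)
  also have "\<dots> = (-1) ^ r * prod_list bs"
    unfolding len[symmetric] by (induction bs) auto
  finally have det: "det ?S * det ?T = prod_list bs"
    using det_mult[OF S T] by simp
  show "0 \<le> det ?S * det ?T"
    unfolding det using bs0 by (induction bs) auto
  \<comment> \<open>The padding zeros come first as all other entries are nonnegative; after
    reversal they are last, and taking \<open>r\<close> entries removes exactly them.\<close>
  have sort: "sort (map sqrt as) = replicate (l - r) 0 @ sort (map sqrt bs)"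
    using as_bs bs0 by (intro properties_for_sort) (auto simp: sorted_append)
  have "singular_values (F * G) = rev (sort (map sqrt as))"
    unfolding singular_values_def as(1) proots_as by (simp flip: mset_map)
  also have "take r \<dots> = rev (sort (map sqrt bs))"
    unfolding sort using len by simp
  finally have "proj_volume r (F * G) = prod_list (map sqrt bs)"
    unfolding proj_volume_def by (metis (no_types) mset_rev mset_sort prod_mset_prod_list)
  also have "\<dots> = sqrt (prod_list bs)"
    by (induction bs) (auto simp: real_sqrt_mult)
  finally show "proj_volume r (F * G) = sqrt (det ?S * det ?T)" unfolding det .
qed

section \<open>Rank factorization\<close>

text \<open>A maximal independent set of columns of \<open>A\<close> supplies the columns of
  \<open>F\<close>; the coordinates of the columns of \<open>A\<close> with respect to it supply the
  columns of \<open>G\<close>.\<close>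

lemma (in vec_space) rank_factorization:
  assumes A: "A \<in> carrier_mat n nc"
  obtains F G where "F \<in> carrier_mat n (rank A)" "G \<in> carrier_mat (rank A) nc" "A = F * G"
proof -
  let ?P = "\<lambda>T. T \<subseteq> set (cols A) \<and> lin_indpt T"
  have "?P {}" by (auto simp: lin_dep_def)
  then obtain S where S: "maximal S ?P" "finite S"
    using maximal_exists_superset[of "set (cols A)" ?P "{}"] by auto
  have card: "card S = rank A"
    using rank_card_indpt[OF A S(1)] by simp
  have P: "S \<subseteq> set (cols A)" "lin_indpt S"
    using S(1) by (auto simp: maximal_def)
  have cA: "set (cols A) \<subseteq> carrier_vec n" using cols_dim A by blast
  obtain ss where ss: "set ss = S" "distinct ss" using finite_distinct_list[OF S(2)] by blast
  let ?r = "rank A"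
  define F where "F = mat_of_cols n ss"
  have len: "length ss = ?r" using ss card distinct_card by fastforce
  have F: "F \<in> carrier_mat n ?r" by (simp add: F_def len[symmetric])
  have colsF: "cols F = ss" unfolding F_def using ss P cA by (intro cols_mat_of_cols) auto
  have "\<exists>g. g \<in> carrier_vec ?r \<and> F *\<^sub>v g = v" if v: "v \<in> set (cols A)" for v
  proof -
    \<comment> \<open>A column outside the span could be added to \<open>S\<close>, against its
      maximality.\<close>
    have "v \<in> span S"
    proof (rule ccontr)
      assume nv: "v \<notin> span S"
      then have "v \<notin> S" using P cA in_own_span by blast
      moreover have "lin_indpt (insert v S)"
        using lin_dep_iff_in_span[of S v] P cA v nv \<open>v \<notin> S\<close> by auto
      ultimately show False
        using S(1) P v unfolding maximal_def by blast
    qed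
    then obtain a where "v = lincomb a S"
      using finite_in_span S(2) P cA by blast
    then show ?thesis
      using mat_mult_eq_lincomb[OF F, of a] ss unfolding colsF
      by (intro exI[of _ "vec ?r (\<lambda>i. a (col F i))"]) auto
  qed
  then obtain g where g: "\<And>v. v \<in> set (cols A) \<Longrightarrow> g v \<in> carrier_vec ?r \<and> F *\<^sub>v g v = v"
    by metis
  define G where "G = mat_of_cols ?r (map g (cols A))"
  have G: "G \<in> carrier_mat ?r nc"
    using A unfolding G_def
    by (metis carrier_matD(2) cols_length length_map mat_of_cols_carrier(1))
  have "A = F * G"
  proof (rule mat_col_eqI)
    fix j assume "j < dim_col (F * G)"
    then have j: "j < nc" using G by simp
    then have *: "col A j \<in> set (cols A)" using A by (auto simp: cols_def)
    have "col G j = g (col A j)"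
      unfolding G_def using j A g[OF *] by (subst col_mat_of_cols) auto
    then show "col A j = col (F * G) j"
      using g[OF *] F G j by (simp add: col_mult2[OF F G j])
  qed (use A F G in auto)
  then show ?thesis using that F G by blast
qed

section \<open>Submatrices of products and Gram matrices of column sets\<close>

lemma pick_lessThan: "i < r \<Longrightarrow> pick {..<r} i = i"
  using pick_reduce_set[of i r UNIV] unfolding pick_UNIV lessThan_def by simp

lemma submatrix_UNIV_carrier:
  assumes "A \<in> carrier_mat r n" "J \<subseteq> {..<n}"
  shows "submatrix A UNIV J \<in> carrier_mat r (card J)"
proof -
  have "{j. j < n \<and> j \<in> J} = J" using assms by auto
  then show ?thesis using assms by (auto simp: dim_submatrix intro!: carrier_matI)
qed

lemma submatrix_mult:
  fixes A B :: "'a :: semiring_0 mat"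
  assumes A: "A \<in> carrier_mat m r" and B: "B \<in> carrier_mat r n"
  shows "submatrix (A * B) I J = submatrix A I UNIV * submatrix B UNIV J"
proof (rule eq_matI)
  fix i j
  assume "i < dim_row (submatrix A I UNIV * submatrix B UNIV J)"
    "j < dim_col (submatrix A I UNIV * submatrix B UNIV J)"
  then have ij: "i < card {i. i < m \<and> i \<in> I}" "j < card {j. j < n \<and> j \<in> J}"
    using A B by (auto simp: dim_submatrix)
  then show "submatrix (A * B) I J $$ (i, j) = (submatrix A I UNIV * submatrix B UNIV J) $$ (i, j)"
    using A B pick_le[OF ij(1)] pick_le[OF ij(2)]
    by (auto simp: submatrix_index dim_submatrix scalar_prod_def pick_UNIV intro!: sum.cong)
qed (use A B in \<open>auto simp: dim_submatrix\<close>)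

lemma submatrix_UNIV_UNIV: "submatrix A UNIV UNIV = A"
  by (rule eq_matI) (auto simp: dim_submatrix submatrix_index pick_UNIV)

lemma transpose_submatrix: "transpose_mat (submatrix A I J) = submatrix (transpose_mat A) J I"
  by (rule eq_matI) (auto simp: dim_submatrix submatrix_index pick_le)

text \<open>Its entries are sums over the set \<open>J\<close>, so it does not see the order in
  which \<open>submatrix\<close> lists the columns. This is what makes column permutations
  harmless.\<close>

definition column_gram :: "real mat \<Rightarrow> nat set \<Rightarrow> real mat" where
  "column_gram A J = submatrix A UNIV J * transpose_mat (submatrix A UNIV J)"

lemma column_gram_carrier: "A \<in> carrier_mat r n \<Longrightarrow> column_gram A J \<in> carrier_mat r r"
  by (auto simp: column_gram_def dim_submatrix intro!: carrier_matI)

lemma column_gram_index: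
  assumes A: "A \<in> carrier_mat r n" and J: "J \<subseteq> {..<n}" and ij: "i < r" "j < r"
  shows "column_gram A J $$ (i, j) = (\<Sum>q\<in>J. A $$ (i, q) * A $$ (j, q))"
proof -
  have J': "{j. j < n \<and> j \<in> J} = J" using J by auto
  have "inj_on (pick J) {0..<card J}"
    by (rule linorder_inj_onI) (use pick_mono_le in \<open>fastforce+\<close>)
  moreover have "pick J ` {0..<card J} \<subseteq> J" using pick_in_set_le by auto
  ultimately have bij: "bij_betw (pick J) {0..<card J} J"
    using J finite_subset[OF J] card_subset_eq[of J "pick J ` {0..<card J}"] by (auto simp: bij_betw_def card_image)
  have "column_gram A J $$ (i, j) = (\<Sum>p\<in>{0..<card J}. A $$ (i, pick J p) * A $$ (j, pick J p))"
    using A ij by (simp add: column_gram_def scalar_prod_def dim_submatrix submatrix_index pick_UNIV J')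
  also have "\<dots> = (\<Sum>q\<in>J. A $$ (i, q) * A $$ (j, q))"
    by (rule sum.reindex_bij_betw[OF bij])
  finally show ?thesis .
qed

text \<open>The product formula with the identity as second factor, whose Gram determinant is
  1.\<close>

lemma det_gram_nonneg:
  fixes A :: "real mat"
  assumes "A \<in> carrier_mat r n"
  shows "0 \<le> det (A * transpose_mat A)"
  using proj_volume_mult(1)[of "transpose_mat A" n r "1\<^sub>m r" r] assms by simp

text \<open>The rows \<open>I\<close> of \<open>F\<close> are treated as columns of its transpose,
  so that one notion of Gram matrix serves the horizontal and the vertical step.\<close>

lemma proj_volume_submatrix_mult:
  assumes F: "F \<in> carrier_mat m r" and G: "G \<in> carrier_mat r n"
    and J: "J \<subseteq> {..<n}" and r: "r \<le> card J"
  shows "proj_volume r (submatrix (F * G) I J)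
    = sqrt (det (column_gram (transpose_mat F) I) * det (column_gram G J))"
proof -
  have "submatrix F I UNIV \<in> carrier_mat (card {i. i < m \<and> i \<in> I}) r"
    using F by (auto simp: dim_submatrix)
  from proj_volume_mult(2)[OF this submatrix_UNIV_carrier[OF G J] r]
  show ?thesis
    by (simp add: submatrix_mult[OF F G] column_gram_def transpose_submatrix)
qed

section \<open>The reduction algorithm: permutation, orthogonal factor and comparison of
  volumes\<close>

lemma reduction_output_index_set:
  assumes "reduction_output h r l V J'"
  shows "J' \<subseteq> {..<dim_col V}" "card J' = l"
proof -
  obtain \<pi> J where "\<pi> permutes {..<dim_col V}" "card J = l" "J' \<subseteq> {..<dim_col V}" "\<pi> ` J' = J"
    using assms unfolding reduction_output_def Let_def by blast
  then show "J' \<subseteq> {..<dim_col V}" "card J' = l"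
    using card_image[OF permutes_inj_on, of \<pi> "{..<dim_col V}" J'] by auto
qed

lemma permutes_image_index_set:
  assumes "\<pi> permutes {..<n}" and "X \<subseteq> {..<n}"
  shows "\<pi> ` X \<subseteq> {..<n}" "card (\<pi> ` X) = card X"
proof -
  have "\<pi> ` X \<subseteq> \<pi> ` {..<n}" using assms(2) by (rule image_mono)
  then show "\<pi> ` X \<subseteq> {..<n}" unfolding permutes_image[OF assms(1)] .
  show "card (\<pi> ` X) = card X" by (rule card_image[OF permutes_inj_on[OF assms(1)]])
qed

lemma mult_perm_mat_index:
  assumes A: "A \<in> carrier_mat r n" and \<pi>: "\<pi> permutes {..<n}" and iq: "i < r" "q < n"
  shows "(A * perm_mat n \<pi>) $$ (i, q) = A $$ (i, \<pi> q)"
proof -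
  have "\<pi> q < n" using permutes_in_image[OF \<pi>, of q] iq by simp
  have "(A * perm_mat n \<pi>) $$ (i, q) = (\<Sum>p = 0..<n. A $$ (i, p) * perm_mat n \<pi> $$ (p, q))"
    using iq A by (simp add: scalar_prod_def perm_mat_def)
  also have "\<dots> = (\<Sum>p = 0..<n. if p = \<pi> q then A $$ (i, p) else 0)"
    by (rule sum.cong[OF refl]) (use iq in \<open>simp add: perm_mat_def\<close>)
  finally show ?thesis using \<open>\<pi> q < n\<close> by simp
qed

text \<open>The increasing listings of \<open>X\<close> and of its image may order corresponding
  columns differently, but the entries of the Gram matrix are sums over the index set.\<close>

lemma column_gram_mult_perm_mat:
  assumes A: "A \<in> carrier_mat r n" and \<pi>: "\<pi> permutes {..<n}" and X: "X \<subseteq> {..<n}"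
  shows "column_gram (A * perm_mat n \<pi>) X = column_gram A (\<pi> ` X)"
proof (rule eq_matI)
  have AP: "A * perm_mat n \<pi> \<in> carrier_mat r n"
    using A by (simp add: perm_mat_def)
  note carrier = column_gram_carrier[OF A, of "\<pi> ` X"] column_gram_carrier[OF AP, of X]
  show "dim_row (column_gram (A * perm_mat n \<pi>) X) = dim_row (column_gram A (\<pi> ` X))"
    "dim_col (column_gram (A * perm_mat n \<pi>) X) = dim_col (column_gram A (\<pi> ` X))"
    using carrier by auto
  fix i j assume "i < dim_row (column_gram A (\<pi> ` X))" "j < dim_col (column_gram A (\<pi> ` X))"
  then have ij: "i < r" "j < r" using carrier by auto
  have "column_gram (A * perm_mat n \<pi>) X $$ (i, j) = (\<Sum>q\<in>X. A $$ (i, \<pi> q) * A $$ (j, \<pi> q))"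
    unfolding column_gram_index[OF AP X ij]
    by (rule sum.cong[OF refl]) (use X ij in \<open>auto simp: mult_perm_mat_index[OF A \<pi>]\<close>)
  also have "\<dots> = column_gram A (\<pi> ` X) $$ (i, j)"
    unfolding column_gram_index[OF A permutes_image_index_set(1)[OF \<pi> X] ij]
    by (simp add: sum.reindex[OF permutes_inj_on[OF \<pi>]])
  finally show "column_gram (A * perm_mat n \<pi>) X $$ (i, j) = column_gram A (\<pi> ` X) $$ (i, j)" .
qed

text \<open>Padding by zero rows becomes multiplication by the first \<open>r\<close> columns of the
  identity, so that associativity can move it into the factor on the left.\<close>

lemma partial_identity_mult:
  fixes A :: "'a :: comm_ring_1 mat"
  defines "E \<equiv> \<lambda>k r. mat k r (\<lambda>(i, j). if i = j then 1 else 0 :: 'a)"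
  assumes A: "A \<in> carrier_mat r n" and r: "r \<le> k"
  shows "E k r * A = A @\<^sub>r 0\<^sub>m (k - r) n"
proof (rule eq_matI)
  fix i j assume "i < dim_row (A @\<^sub>r 0\<^sub>m (k - r) n)" "j < dim_col (A @\<^sub>r 0\<^sub>m (k - r) n)"
  then have ij: "i < k" "j < n" using A r by (auto simp: append_rows_def)
  have "(E k r * A) $$ (i, j) = (\<Sum>p = 0..<r. E k r $$ (i, p) * A $$ (p, j))"
    using ij A by (simp add: E_def scalar_prod_def)
  also have "\<dots> = (\<Sum>p = 0..<r. if p = i then A $$ (p, j) else 0)"
    by (rule sum.cong[OF refl]) (use ij in \<open>simp add: E_def\<close>)
  also have "\<dots> = (A @\<^sub>r 0\<^sub>m (k - r) n) $$ (i, j)"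
    using ij A r by (simp add: append_rows_def)
  finally show "(E k r * A) $$ (i, j) = (A @\<^sub>r 0\<^sub>m (k - r) n) $$ (i, j)" .
qed (use A r in \<open>auto simp: E_def append_rows_def\<close>)

lemma transpose_partial_identity_mult:
  fixes k r :: nat
  defines "E \<equiv> mat k r (\<lambda>(i, j). if i = j then 1 else 0 :: 'a :: comm_ring_1)"
  assumes r: "r \<le> k"
  shows "transpose_mat E * E = 1\<^sub>m r"
proof (rule eq_matI)
  fix i j assume "i < dim_row (1\<^sub>m r :: 'a mat)" "j < dim_col (1\<^sub>m r :: 'a mat)"
  then have ij: "i < r" "j < r" by auto
  have "(transpose_mat E * E) $$ (i, j) = (\<Sum>p = 0..<k. E $$ (p, i) * E $$ (p, j))"
    using ij by (simp add: E_def scalar_prod_def)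
  also have "\<dots> = (\<Sum>p = 0..<k. if p = i then (if i = j then 1 else 0) else 0)"
    by (rule sum.cong[OF refl]) (use ij r in \<open>simp add: E_def\<close>)
  also have "\<dots> = 1\<^sub>m r $$ (i, j)"
    using ij r by simp
  finally show "(transpose_mat E * E) $$ (i, j) = 1\<^sub>m r $$ (i, j)" .
qed (auto simp: E_def)

lemma orthogonal_mult_append_rows_zero:
  fixes Q A :: "'a :: comm_ring_1 mat"
  assumes Q: "Q \<in> carrier_mat k k" "transpose_mat Q * Q = 1\<^sub>m k"
    and A: "A \<in> carrier_mat r n" and r: "r \<le> k"
  obtains F where "F \<in> carrier_mat k r" "transpose_mat F * F = 1\<^sub>m r"
    "Q * (A @\<^sub>r 0\<^sub>m (k - r) n) = F * A"
proof
  let ?E = "mat k r (\<lambda>(i, j). if i = j then 1 else 0 :: 'a)"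
  have E: "?E \<in> carrier_mat k r" by simp
  show "Q * ?E \<in> carrier_mat k r" using Q(1) E by (rule mult_carrier_mat)
  have "transpose_mat (Q * ?E) * (Q * ?E) = transpose_mat ?E * (transpose_mat Q * Q * ?E)"
    unfolding transpose_mult[OF Q(1) E] using Q(1) E
    by (simp add: assoc_mult_mat[of _ r k _ k _ r] assoc_mult_mat[of _ k k _ k _ r])
  then show "transpose_mat (Q * ?E) * (Q * ?E) = 1\<^sub>m r"
    unfolding Q(2) left_mult_one_mat[OF E] transpose_partial_identity_mult[OF r] .
  show "Q * (A @\<^sub>r 0\<^sub>m (k - r) n) = Q * ?E * A"
    unfolding partial_identity_mult[OF A r, symmetric]
    by (rule assoc_mult_mat[OF Q(1) E A, symmetric])
qed

text \<open>The product formula with the identity as first factor; by \<open>r \<le> card J\<close>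
  the volume is the \<open>r\<close>-projective volume.\<close>

lemma volume_submatrix_UNIV:
  assumes A: "A \<in> carrier_mat r n" and J: "J \<subseteq> {..<n}" and r: "r \<le> card J"
  shows "volume (submatrix A UNIV J) = sqrt (det (column_gram A J))"
proof -
  have S: "submatrix A UNIV J \<in> carrier_mat r (card J)"
    by (rule submatrix_UNIV_carrier[OF A J])
  then have "volume (submatrix A UNIV J) = proj_volume r (1\<^sub>m r * submatrix A UNIV J)"
    using r by (simp add: volume_def min_def)
  then show ?thesis
    by (simp add: proj_volume_mult(2)[OF one_carrier_mat S r] column_gram_def)
qed

text \<open>Both sides are the squared \<open>r\<close>-projective volume of the columns
  \<open>J\<close> of the common product. Two factorizations are thus compared without a change of
  basis between them.\<close>

lemma det_column_gram_unique:
  assumes F1: "F1 \<in> carrier_mat k r" and F2: "F2 \<in> carrier_mat k r"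
    and G1: "G1 \<in> carrier_mat r n" and G2: "G2 \<in> carrier_mat r n"
    and eq: "F1 * G1 = F2 * G2" and J: "J \<subseteq> {..<n}" and r: "r \<le> card J"
  shows "det (transpose_mat F1 * F1) * det (column_gram G1 J)
    = det (transpose_mat F2 * F2) * det (column_gram G2 J)"
proof -
  have "proj_volume r (submatrix (F1 * G1) UNIV J) = proj_volume r (submatrix (F2 * G2) UNIV J)"
    by (simp add: eq)
  then show ?thesis
    unfolding proj_volume_submatrix_mult[OF F1 G1 J r] proj_volume_submatrix_mult[OF F2 G2 J r]
    by (simp add: column_gram_def submatrix_UNIV_UNIV)
qed

text \<open>Membership in \<open>submatrices\<close> requires a row set within range, so
  \<open>{..<r}\<close> stands in for \<open>UNIV\<close>.\<close>

lemma submatrix_UNIV_in_submatrices: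
  assumes A: "A \<in> carrier_mat r n" and J: "J \<subseteq> {..<n}"
  shows "submatrix A UNIV J \<in> submatrices r (card J) A"
proof -
  have "submatrix A UNIV J = submatrix A {..<r} J"
    using A by (auto simp: submatrix_def pick_UNIV pick_lessThan intro!: eq_matI)
  then show ?thesis
    unfolding submatrices_def using A J by (intro CollectI exI[of _ "{..<r}"] exI[of _ J]) auto
qed

text \<open>\<open>V = Q R P\<close> is a second factorization \<open>V = F\<^sub>2 (R' P)\<close>, with \<open>F\<^sub>2\<close> the first \<open>r\<close> columns of
  \<open>Q\<close>. As \<open>F\<^sub>2\<^sup>T F\<^sub>2 = 1\<close>, volumes of submatrices of \<open>R'\<close> are projective volumes of
  submatrices of \<open>V\<close>.\<close>
lemma reduction_output_det_column_gram_le: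
  assumes red: "reduction_output h r l V J'" and V: "V = F * G"
    and F: "F \<in> carrier_mat k r" and G: "G \<in> carrier_mat r n"
    and r: "r \<le> k" "r \<le> l" and F0: "det (transpose_mat F * F) \<noteq> 0" and h: "0 \<le> h"
    and J: "J \<subseteq> {..<n}" "card J = l"
  shows "det (column_gram G J) \<le> h\<^sup>2 * det (column_gram G J')"
proof -
  have dims: "dim_row V = k" "dim_col V = n" using V F G by auto
  obtain Q R R' \<pi> J0 where
    Q: "Q \<in> carrier_mat k k" "transpose_mat Q * Q = 1\<^sub>m k" and
    R': "R' \<in> carrier_mat r n" and R: "R = R' @\<^sub>r 0\<^sub>m (k - r) n" and
    \<pi>: "\<pi> permutes {..<n}" and VQ: "V = Q * R * perm_mat n \<pi>" and
    max: "h_maximal volume h (submatrices r l R') (submatrix R' UNIV J0)" and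
    J': "J' \<subseteq> {..<n}" "\<pi> ` J' = J0"
    using red unfolding reduction_output_def Let_def dims by blast
  have cJ': "card J' = l"
    by (rule reduction_output_index_set(2)[OF red])
  obtain F2 where F2: "F2 \<in> carrier_mat k r" and F2F2: "transpose_mat F2 * F2 = 1\<^sub>m r"
    and QR: "Q * R = F2 * R'"
    using orthogonal_mult_append_rows_zero[OF Q R' r(1)] unfolding R by metis
  have P: "perm_mat n \<pi> \<in> carrier_mat n n" by (simp add: perm_mat_def)
  have eq: "F * G = F2 * (R' * perm_mat n \<pi>)"
    unfolding V[symmetric] VQ QR by (rule assoc_mult_mat[OF F2 R' P])
  \<comment> \<open>The factor coming from \<open>F\<close> is the same for all \<open>X\<close>, so
    comparing volumes in \<open>R'\<close> amounts to comparing Gram determinants of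
    \<open>G\<close>.\<close>
  have vol: "volume (submatrix R' UNIV (\<pi> ` X)) = sqrt (det (transpose_mat F * F) * det (column_gram G X))"
    if X: "X \<subseteq> {..<n}" "card X = l" for X
  proof -
    note \<pi>X = permutes_image_index_set[OF \<pi> X(1)]
    have "r \<le> card X" using X r by simp
    note gram = det_column_gram_unique[OF F F2 G mult_carrier_mat[OF R' P] eq X(1) this]
    show ?thesis
      unfolding gram F2F2 column_gram_mult_perm_mat[OF R' \<pi> X(1)]
      using volume_submatrix_UNIV[OF R' \<pi>X(1)] \<pi>X(2) X(2) r(2) by simp
  qed
  \<comment> \<open>The competitor in \<open>R'\<close> is the image under \<open>\<pi>\<close> of
    the given columns \<open>J\<close> of \<open>V\<close>.\<close>
  have "submatrix R' UNIV (\<pi> ` J) \<in> submatrices r l R'"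
    using submatrix_UNIV_in_submatrices[OF R' permutes_image_index_set(1)[OF \<pi> J(1)]]
      permutes_image_index_set(2)[OF \<pi> J(1)] J(2) by simp
  then have "volume (submatrix R' UNIV (\<pi> ` J)) \<le> h * volume (submatrix R' UNIV (\<pi> ` J'))"
    using max J'(2) unfolding h_maximal_def by simp
  then have "sqrt (det (transpose_mat F * F) * det (column_gram G J))
    \<le> sqrt (det (transpose_mat F * F) * (h\<^sup>2 * det (column_gram G J')))"
    unfolding vol[OF J] vol[OF J'(1) cJ'] using h
    by (simp add: real_sqrt_mult mult_ac)
  \<comment> \<open>A nonzero Gram determinant is positive, hence can be cancelled under the
    root.\<close>
  moreover have "0 < det (transpose_mat F * F)"
    using det_gram_nonneg[of "transpose_mat F" r k] F F0 by simp
  ultimately show ?thesis by simp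
qed

section \<open>Combination of the horizontal and the vertical step\<close>

theorem theorem13p1:
  fixes W W1 W2 :: "real mat" and k l m n r :: nat and h h' :: real
    and I1 J1 I2 J2 :: "nat set"
  assumes "0 < r" "r \<le> k" "k \<le> m" "r \<le> l" "l \<le> n"
    and "1 \<le> h" "1 \<le> h'"
    and "W \<in> carrier_mat m n" "vec_space.rank m W = r"
    and "I1 \<subseteq> {..<m}" "card I1 = k"
    and "horizontal_step h r l W I1 J1" "W1 = submatrix W I1 J1"
    and "J2 = J1" "vertical_step h' r k W J2 I2" "W2 = submatrix W I2 J2"
    and "proj_volume r W1 \<noteq> 0"
    and "columnwise_locally_h_maximal (proj_volume r) h W I1 J1"
    and "proj_volume r W2 \<noteq> 0"
    and "rowwise_locally_h_maximal (proj_volume r) h' W I2 J2"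
  shows "h_maximal (proj_volume r) (h' * h) (submatrices k l W) W2"
proof -
  note rk = \<open>r \<le> k\<close> and rl = \<open>r \<le> l\<close> and W = \<open>W \<in> carrier_mat m n\<close>
  obtain F G where F: "F \<in> carrier_mat m r" and G: "G \<in> carrier_mat r n" and WFG: "W = F * G"
    using vec_space.rank_factorization[OF W] \<open>vec_space.rank m W = r\<close> by metis
  let ?a = "\<lambda>I. det (column_gram (transpose_mat F) I)" and ?b = "\<lambda>J. det (column_gram G J)"
  have FT: "transpose_mat F \<in> carrier_mat r m" using F by simp
  have J1: "J1 \<subseteq> {..<n}" "card J1 = l"
    using reduction_output_index_set[of h r l "submatrix W I1 UNIV" J1] \<open>horizontal_step h r l W I1 J1\<close> W
    by (auto simp: horizontal_step_def dim_submatrix)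
  have F1: "submatrix F I1 UNIV \<in> carrier_mat k r"
    using submatrix_UNIV_carrier[OF FT \<open>I1 \<subseteq> {..<m}\<close>] \<open>card I1 = k\<close>
    by (simp flip: transpose_submatrix)
  have G1: "submatrix G UNIV J1 \<in> carrier_mat r l"
    using submatrix_UNIV_carrier[OF G J1(1)] J1 by simp
  \<comment> \<open>Nonvanishing splits over the two factors: \<open>?a I1\<close> is what has to be
    cancelled in the horizontal step, \<open>?b J1\<close> in the vertical one.\<close>
  have "?a I1 * ?b J1 \<noteq> 0"
    using \<open>proj_volume r W1 \<noteq> 0\<close> proj_volume_submatrix_mult[OF F G J1(1), of I1] rl J1(2)
    unfolding \<open>W1 = submatrix W I1 J1\<close> WFG by auto
  then have a1: "?a I1 \<noteq> 0" and b1: "?b J1 \<noteq> 0" by auto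
  \<comment> \<open>The right factor of the row block is the \<open>G\<close> of \<open>W\<close>
    itself, so the bound no longer refers to the rows \<open>I1\<close>.\<close>
  have b: "?b J \<le> h\<^sup>2 * ?b J1" if "J \<subseteq> {..<n}" "card J = l" for J
  proof (rule reduction_output_det_column_gram_le[OF _ _ F1 G rk rl _ _ that])
    show "reduction_output h r l (submatrix W I1 UNIV) J1"
      using assms by (simp add: horizontal_step_def)
    show "submatrix W I1 UNIV = submatrix F I1 UNIV * G"
      by (simp add: WFG submatrix_mult[OF F G] submatrix_UNIV_UNIV)
    show "det (transpose_mat (submatrix F I1 UNIV) * submatrix F I1 UNIV) \<noteq> 0"
      using a1 by (simp add: column_gram_def transpose_submatrix)
  qed (use assms in auto)
  \<comment> \<open>For the transposed column block the right factor is the transpose of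
    \<open>F\<close>, and \<open>k\<close> and \<open>l\<close> exchange their roles.\<close>
  have a: "?a I \<le> h'\<^sup>2 * ?a I2" if "I \<subseteq> {..<m}" "card I = k" for I
  proof (rule reduction_output_det_column_gram_le[OF _ _ _ FT rl rk _ _ that])
    show "reduction_output h' r k (transpose_mat (submatrix W UNIV J1)) I2"
      using assms by (simp add: vertical_step_def)
    show "transpose_mat (submatrix W UNIV J1) = transpose_mat (submatrix G UNIV J1) * transpose_mat F"
      by (simp add: WFG submatrix_mult[OF F G] submatrix_UNIV_UNIV transpose_mult[OF F G1])
    show "det (transpose_mat (transpose_mat (submatrix G UNIV J1)) * transpose_mat (submatrix G UNIV J1)) \<noteq> 0"
      using b1 by (simp add: column_gram_def)
  qed (use assms G1 in auto)
  have nn: "0 \<le> det (column_gram A X)" if "A \<in> carrier_mat r p" for A X p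
    unfolding column_gram_def using that by (intro det_gram_nonneg[OF carrier_matI]) (auto simp: dim_submatrix)
  show ?thesis
    unfolding h_maximal_def
  proof
    fix B assume "B \<in> submatrices k l W"
    then obtain I J where B: "B = submatrix W I J" and I: "I \<subseteq> {..<m}" "card I = k"
      and J: "J \<subseteq> {..<n}" "card J = l"
      using W unfolding submatrices_def by auto
    have "proj_volume r B = sqrt (?a I * ?b J)"
      unfolding B WFG using J rl by (intro proj_volume_submatrix_mult[OF F G]) auto
    \<comment> \<open>Gram determinants are nonnegative, so the bounds for arbitrary
      \<open>I\<close> and \<open>J\<close> may be multiplied.\<close>
    also have "\<dots> \<le> sqrt ((h'\<^sup>2 * ?a I2) * (h\<^sup>2 * ?b J1))"
      by (intro real_sqrt_le_mono mult_mono a b I J mult_nonneg_nonneg nn[OF FT] nn[OF G]) auto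
    also have "\<dots> = h' * h * sqrt (?a I2 * ?b J1)"
      using assms by (simp add: real_sqrt_mult)
    also have "sqrt (?a I2 * ?b J1) = proj_volume r W2"
      unfolding \<open>W2 = submatrix W I2 J2\<close> \<open>J2 = J1\<close> WFG
      using J1 rl by (intro proj_volume_submatrix_mult[OF F G, symmetric]) auto
    finally show "proj_volume r B \<le> h' * h * proj_volume r W2" .
  qed
qed

end
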